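(* Let $(X,d)$ be a metric space, $Z$ a nonempty set, and let $\mathcal{A}\subset X\times Z$ be a nonempty set preordered by $\preceq$. Assume that for every $\preceq$-decreasing sequence $((x_n,z_n))_{n\ge 1}\subset\mathcal{A}$ the sequence $(x_n)_{n\ge1}$ is Cauchy and there exists $(x,z)\in\mathcal{A}$ such that $(x,z)\preceq(x_n,z_n)$ for all $n\ge1$. Then for every $(x,z)\in\mathcal{A}$ there exists $(\overline{x},\overline{z})\in\mathcal{A}$ such that $(\overline{x},\overline{z})\preceq(x,z)$ and, for every $(x',z')\in\mathcal{A}$, $(x',z')\preceq(\overline{x},\overline{z})$ implies $x'=\overline{x}$.
   Context: A preorder is a reflexive and transitive relation. A sequence $(w_n)_{n\ge1}$ is $\preceq$-decreasing if $w_{n+1}\preceq w_n$ for all $n\ge1$. *)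

theory Defs
  imports "HOL-Analysis.Analysis"
begin

text \<open>
  A relation is a set of pairs, and \<open>(v, w) \<in> r\<close> is read as \<open>v \<preceq> w\<close>. Sequences
  \<open>(w\<^sub>n)\<close> with \<open>n \<ge> 1\<close> are represented as functions on \<open>nat\<close>, with the index shifted
  to start at \<open>0\<close>.
\<close>

definition decreasing_wrt :: "('a \<times> 'a) set \<Rightarrow> (nat \<Rightarrow> 'a) \<Rightarrow> bool" where
  "decreasing_wrt r w \<longleftrightarrow> (\<forall>n. (w (Suc n), w n) \<in> r)"

end

theory Submission
  imports Defs
begin

text \<open>
  Below every element there is, for each \<open>\<epsilon> > 0\<close>, an element all of whose predecessors
  lie within \<open>\<epsilon>\<close> of it in the first coordinate: otherwise dependent choice yields a
  decreasing sequence with all steps of length at least \<open>\<epsilon>\<close>, which is not Cauchy.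
  Choosing such elements successively for \<open>\<epsilon> = 1/(n+1)\<close> and taking a lower bound of the
  resulting decreasing sequence gives the minimal element.
\<close>

lemma (in Metric_space) exists_small_lower_section:
  assumes "preorder_on A r"
    and Cauchy: "\<And>w. \<lbrakk>\<forall>n. w n \<in> A; decreasing_wrt r w\<rbrakk> \<Longrightarrow> MCauchy (\<lambda>n. f (w n))"
    and "u \<in> A" "\<epsilon> > 0"
  obtains v where "v \<in> A" "(v, u) \<in> r" "\<And>v'. \<lbrakk>v' \<in> A; (v', v) \<in> r\<rbrakk> \<Longrightarrow> d (f v') (f v) < \<epsilon>"
proof (rule ccontr)
  assume "\<not> thesis"
  with that have far: "\<exists>v'\<in>A. (v', v) \<in> r \<and> \<epsilon> \<le> d (f v') (f v)" if "v \<in> A" "(v, u) \<in> r" for v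
    using \<open>v \<in> A\<close> \<open>(v, u) \<in> r\<close> by (meson not_le)
  have refl: "refl_on A r" and trans: "trans r"
    using assms(1) by (auto simp: preorder_on_def)
  \<comment> \<open>The invariant \<open>(w n, u) \<in> r\<close> is carried along because
    \<open>far\<close> only supplies distant predecessors of elements below
    \<open>u\<close>.\<close>
  have "\<exists>w. \<forall>n. (w n \<in> A \<and> (w n, u) \<in> r) \<and>
      (w (Suc n), w n) \<in> r \<and> \<epsilon> \<le> d (f (w (Suc n))) (f (w n))"
  proof (rule dependent_nat_choice)
    show "\<exists>v. v \<in> A \<and> (v, u) \<in> r"
      using \<open>u \<in> A\<close> refl by (auto dest: refl_onD)
  next
    fix v and n :: nat assume v: "v \<in> A \<and> (v, u) \<in> r"
    then show "\<exists>y. (y \<in> A \<and> (y, u) \<in> r) \<and> (y, v) \<in> r \<and> \<epsilon> \<le> d (f y) (f v)"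
      using far[of v] transD[OF trans] by blast
  qed
  then obtain w where w: "\<And>n. w n \<in> A" "\<And>n. (w (Suc n), w n) \<in> r"
    "\<And>n. \<epsilon> \<le> d (f (w (Suc n))) (f (w n))"
    by blast
  then have "MCauchy (\<lambda>n. f (w n))"
    by (intro Cauchy) (auto simp: decreasing_wrt_def)
  then obtain N where "\<And>m n. \<lbrakk>N \<le> m; N \<le> n\<rbrakk> \<Longrightarrow> d (f (w m)) (f (w n)) < \<epsilon>"
    using \<open>\<epsilon> > 0\<close> unfolding MCauchy_def by meson
  \<comment> \<open>Two consecutive terms already violate the Cauchy condition for
    \<epsilon>.\<close>
  from this[of "Suc N" N] w(3)[of N] show False by simp
qed

text \<open>A lower bound \<open>v\<close> of the chosen sequence and any \<open>v'\<close> below it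
  are both predecessors of every \<open>w n\<close>, so \<open>f v\<close> and \<open>f v'\<close>
  lie within \<open>1 / real (Suc n)\<close> of \<open>f (w n)\<close> for all \<open>n\<close> and
  must coincide. The theorem is the case \<open>f = fst\<close>.\<close>

lemma (in Metric_space) exists_minimal_up_to_map:
  assumes "f ` A \<subseteq> M"
    and "preorder_on A r"
    and Cauchy: "\<And>w. \<lbrakk>\<forall>n. w n \<in> A; decreasing_wrt r w\<rbrakk> \<Longrightarrow> MCauchy (\<lambda>n. f (w n))"
    and bound: "\<And>w. \<lbrakk>\<forall>n. w n \<in> A; decreasing_wrt r w\<rbrakk> \<Longrightarrow> \<exists>v\<in>A. \<forall>n. (v, w n) \<in> r"
    and "u \<in> A"
  shows "\<exists>v\<in>A. (v, u) \<in> r \<and> (\<forall>v'\<in>A. (v', v) \<in> r \<longrightarrow> f v' = f v)"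
proof -
  have trans: "trans r"
    using assms(2) by (auto simp: preorder_on_def)
  let ?P = "\<lambda>n v. v \<in> A \<and> (v, u) \<in> r \<and>
    (\<forall>v'\<in>A. (v', v) \<in> r \<longrightarrow> d (f v') (f v) < 1 / real (Suc n))"
  \<comment> \<open>The case \<open>a = u\<close> starts the sequence; the case
    \<open>(a, u) \<in> r\<close> extends it, with \<open>a\<close> the previous term.\<close>
  have small: "\<exists>v. ?P n v \<and> (v, a) \<in> r" if a: "a \<in> A" "a = u \<or> (a, u) \<in> r" for a n
  proof -
    obtain v where "v \<in> A" "(v, a) \<in> r"
      "\<And>v'. \<lbrakk>v' \<in> A; (v', v) \<in> r\<rbrakk> \<Longrightarrow> d (f v') (f v) < 1 / real (Suc n)"
      by (rule exists_small_lower_section[where f = f and \<epsilon> = "1 / real (Suc n)", OF assms(2) Cauchy a(1)]) auto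
    then show ?thesis
      using a(2) transD[OF trans] by blast
  qed
  have "\<exists>w. \<forall>n. ?P n (w n) \<and> (w (Suc n), w n) \<in> r"
    by (rule dependent_nat_choice) (use small \<open>u \<in> A\<close> in blast)+
  then obtain w where w: "\<And>n. ?P n (w n)" and dec: "\<And>n. (w (Suc n), w n) \<in> r"
    by blast
  obtain v where v: "v \<in> A" "\<And>n. (v, w n) \<in> r"
    using bound[of w] w dec by (auto simp: decreasing_wrt_def)
  have "f v' = f v" if v': "v' \<in> A" "(v', v) \<in> r" for v'
  proof (rule ccontr)
    \<comment> \<open>Distinct points are known to have positive distance only inside the carrier
      \<open>M\<close>.\<close>
    have M: "f v' \<in> M" "f v \<in> M" "f (w n) \<in> M" for n
      using assms(1) v v' w by auto
    assume "f v' \<noteq> f v"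
    then have "d (f v') (f v) / 2 > 0"
      using M by simp
    \<comment> \<open>Half the distance is taken because the triangle inequality through
      \<open>f (w n)\<close> uses the radius \<open>1 / real (Suc n)\<close> twice.\<close>
    then obtain n where n: "1 / real (Suc n) < d (f v') (f v) / 2"
      using nat_approx_posE by blast
    have "d (f v') (f (w n)) < 1 / real (Suc n)" "d (f v) (f (w n)) < 1 / real (Suc n)"
      using w v v' transD[OF trans] by blast+
    then show False
      using n triangle'[OF M(1) M(3) M(2), of n] by linarith
  qed
  moreover have "(v, u) \<in> r"
    using v(2) w transD[OF trans] by blast
  ultimately show ?thesis
    using v(1) by blast
qed

theorem theorem3p7:
  fixes X :: "'a set" and d :: "'a \<Rightarrow> 'a \<Rightarrow> real"
    and Z :: "'b set"
    and A :: "('a \<times> 'b) set"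
    and r :: "(('a \<times> 'b) \<times> ('a \<times> 'b)) set"
  assumes "Metric_space X d"
    and "Z \<noteq> {}"
    and "A \<subseteq> X \<times> Z"
    and "A \<noteq> {}"
    and "preorder_on A r"
    and "\<And>x z. \<lbrakk>\<forall>n. (x n, z n) \<in> A; decreasing_wrt r (\<lambda>n. (x n, z n))\<rbrakk> \<Longrightarrow>
           Metric_space.MCauchy X d x \<and>
           (\<exists>(x', z')\<in>A. \<forall>n. ((x', z'), (x n, z n)) \<in> r)"
  shows "\<forall>(x, z)\<in>A. \<exists>(x\<^sub>0, z\<^sub>0)\<in>A. ((x\<^sub>0, z\<^sub>0), (x, z)) \<in> r \<and>
           (\<forall>(x', z')\<in>A. ((x', z'), (x\<^sub>0, z\<^sub>0)) \<in> r \<longrightarrow> x' = x\<^sub>0)"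
proof -
  interpret Metric_space X d by fact
  \<comment> \<open>The hypothesis speaks of two component sequences; splitting \<open>w\<close> by
    \<open>fst\<close> and \<open>snd\<close> turns it into one about sequences of pairs.\<close>
  have seq: "MCauchy (\<lambda>n. fst (w n)) \<and> (\<exists>v\<in>A. \<forall>n. (v, w n) \<in> r)"
    if "\<forall>n. w n \<in> A" "decreasing_wrt r w" for w
    using assms(6)[of "\<lambda>n. fst (w n)" "\<lambda>n. snd (w n)"] that by auto
  have "\<exists>v\<in>A. (v, u) \<in> r \<and> (\<forall>v'\<in>A. (v', v) \<in> r \<longrightarrow> fst v' = fst v)" if "u \<in> A" for u
    using exists_minimal_up_to_map[of fst A r u] assms(3,5) seq that by fastforce
  then show ?thesis
    by fastforce
qed

end
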